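(* Let $I\subset[0,\infty)$ be an interval, let $a,b\in I$ with $a<b$, and let $f:I\to\mathbb{R}$ be differentiable on the interior $I^{\circ}$ of $I$ and at $a$ and $b$, with $f'\in L[a,b]$. Suppose that $|f'|^2$ is convex on $[a,b]$. Then for every division $d: a=x_0<x_1<\dots<x_{n-1}<x_n=b$ of $[a,b]$, the midpoint error $E(f,d)$ satisfies $$|E(f,d)|\le \frac{1}{2\sqrt6}\sum_{i=0}^{n-1}(x_{i+1}-x_i)^2\left[|f'(x_{i+1})|^2+|f'(x_i)|^2\right]^{1/2}.$$
   Context: For a division $d: a=x_0<x_1<\dots<x_n=b$, the midpoint sum is $T(f,d)=\sum_{i=0}^{n-1} f\left(\frac{x_i+x_{i+1}}{2}\right)(x_{i+1}-x_i)$ and the error is $E(f,d)=\int_a^b f(x)\,dx-T(f,d)$. $L[a,b]$ denotes the Lebesgue integrable functions on $[a,b]$. If $a$ or $b$ is an endpoint of $I$, differentiability there is one-sided (within $I$). *)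

theory Defs
  imports "HOL-Analysis.Analysis"
begin

(* A division with n subintervals is a sequence of which only x 0, ..., x n matter. *)
definition is_division :: "real \<Rightarrow> real \<Rightarrow> nat \<Rightarrow> (nat \<Rightarrow> real) \<Rightarrow> bool" where
  "is_division a b n x \<longleftrightarrow> x 0 = a \<and> x n = b \<and> (\<forall>i<n. x i < x (Suc i))"

definition midpoint_sum :: "(real \<Rightarrow> real) \<Rightarrow> nat \<Rightarrow> (nat \<Rightarrow> real) \<Rightarrow> real" where
  "midpoint_sum f n x = (\<Sum>i<n. f ((x i + x (Suc i)) / 2) * (x (Suc i) - x i))"

(* x 0 and x n are the endpoints a and b of the divided interval. *)
definition midpoint_error :: "(real \<Rightarrow> real) \<Rightarrow> nat \<Rightarrow> (nat \<Rightarrow> real) \<Rightarrow> real" where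
  "midpoint_error f n x = integral {x 0..x n} f - midpoint_sum f n x"

end

theory Submission
  imports Defs
begin

text \<open>
  On a subinterval \<open>[u, v]\<close> of length \<open>h\<close> with midpoint \<open>m\<close>, integration by parts writes the error as
  minus the integral of \<open>k f'\<close>, where \<open>k t = t - u\<close> on \<open>[u, m]\<close> and \<open>k t = t - v\<close> on \<open>[m, v]\<close>.
  Instead of the Cauchy--Schwarz inequality for integrals, we use the pointwise bound
  \<open>\<bar>k f'\<bar> \<le> c k\<^sup>2 / 2 + f'\<^sup>2 / (2 c)\<close>, in which convexity replaces \<open>f'\<^sup>2\<close> by its chord, and optimise the
  constant \<open>c\<close>. The dominating function is then a polynomial, and no integrability of \<open>f'\<^sup>2\<close> is needed.
\<close>

text \<open>The product \<open>(t - p) * f t\<close> has derivative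
  \<open>f t + (t - p) * f' t\<close>, so the quantity inside the absolute value is the integral of
  \<open>(t - p) * f' t\<close>; the fundamental theorem supplies its integrability. The dominating
  function \<open>g\<close> enters through an antiderivative \<open>H\<close>, which makes the bound
  explicit.\<close>

lemma parts_integral_bound:
  fixes f f' :: "real \<Rightarrow> real"
  assumes lr: "l \<le> r"
    and deriv: "\<And>t. t \<in> {l..r} \<Longrightarrow> (f has_real_derivative f' t) (at t within {l..r})"
    and H: "\<And>t. t \<in> {l..r} \<Longrightarrow> (H has_real_derivative g t) (at t within {l..r})"
    and le: "\<And>t. t \<in> {l..r} \<Longrightarrow> \<bar>(t - p) * f' t\<bar> \<le> g t"
  shows "\<bar>(r - p) * f r - (l - p) * f l - integral {l..r} f\<bar> \<le> H r - H l"
proof -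
  have "continuous_on {l..r} f"
    by (rule DERIV_continuous_on) (rule deriv)
  then have fi: "(f has_integral integral {l..r} f) {l..r}"
    by (simp add: integrable_continuous_real integrable_integral)
  have "((\<lambda>t. f t + (t - p) * f' t) has_integral ((r - p) * f r - (l - p) * f l)) {l..r}"
    using lr
  proof (rule fundamental_theorem_of_calculus)
    fix t assume "t \<in> {l..r}"
    then have "((\<lambda>t. (t - p) * f t) has_real_derivative f t + (t - p) * f' t) (at t within {l..r})"
      by (auto intro!: derivative_eq_intros deriv simp: algebra_simps)
    then show "((\<lambda>t. (t - p) * f t) has_vector_derivative f t + (t - p) * f' t) (at t within {l..r})"
      by (simp add: has_real_derivative_iff_has_vector_derivative)
  qed
  from has_integral_diff[OF this fi]
  have ki: "((\<lambda>t. (t - p) * f' t) has_integral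
      ((r - p) * f r - (l - p) * f l - integral {l..r} f)) {l..r}"
    by simp
  have gi: "(g has_integral (H r - H l)) {l..r}"
    using lr H by (intro fundamental_theorem_of_calculus)
      (auto simp: has_real_derivative_iff_has_vector_derivative)
  have "norm (integral {l..r} (\<lambda>t. (t - p) * f' t)) \<le> integral {l..r} g"
    using ki gi le by (intro integral_norm_bound_integral) (auto simp: integrable_on_def)
  then show ?thesis
    using integral_unique[OF ki] integral_unique[OF gi] by simp
qed

lemma convex_on_le_chord:
  fixes g :: "real \<Rightarrow> real"
  assumes "convex_on {u..v} g" "u < v" "t \<in> {u..v}"
  shows "g t \<le> (g u * (v - t) + g v * (t - u)) / (v - u)"
proof -
  have "g t \<le> (g v - g u) / (v - u) * (t - u) + g u"
    using assms by (intro convex_onD_Icc') auto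
  also have "\<dots> = (g u * (v - t) + g v * (t - u)) / (v - u)"
    using assms(2) by (simp add: field_simps)
  finally show ?thesis .
qed

text \<open>The case \<open>c = 0\<close>, where \<open>1 / c = 0\<close>, covers intervals on which \<open>y\<close> vanishes.\<close>

lemma abs_mult_le_weighted_squares:
  fixes c k y s :: real
  assumes "c \<ge> 0" "y\<^sup>2 \<le> s" "c = 0 \<Longrightarrow> s = 0"
  shows "\<bar>k * y\<bar> \<le> c * k\<^sup>2 / 2 + s / (2 * c)"
proof (cases "c = 0")
  case True
  with assms show ?thesis by simp
next
  case False
  with assms have c: "c > 0" by simp
  have "0 \<le> (c * \<bar>k\<bar> - \<bar>y\<bar>)\<^sup>2" by simp
  then have "2 * c * \<bar>k * y\<bar> \<le> c\<^sup>2 * k\<^sup>2 + y\<^sup>2"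
    by (simp add: power2_diff power_mult_distrib abs_mult algebra_simps)
  also have "\<dots> \<le> c\<^sup>2 * k\<^sup>2 + s"
    using assms by simp
  finally show ?thesis
    using c by (simp add: field_simps power2_eq_square)
qed

lemma midpoint_rule_error:
  fixes f f' :: "real \<Rightarrow> real"
  assumes uv: "u < v"
    and deriv: "\<And>t. t \<in> {u..v} \<Longrightarrow> (f has_real_derivative f' t) (at t within {u..v})"
    and conv: "convex_on {u..v} (\<lambda>t. (f' t)\<^sup>2)"
  shows "\<bar>integral {u..v} f - f ((u + v) / 2) * (v - u)\<bar>
    \<le> 1 / (2 * sqrt 6) * ((v - u)\<^sup>2 * sqrt ((f' v)\<^sup>2 + (f' u)\<^sup>2))"
proof -
  define h m A B where "h = v - u" and "m = (u + v) / 2" and "A = (f' u)\<^sup>2" and "B = (f' v)\<^sup>2"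
  \<comment> \<open>This \<open>c\<close> minimises the final bound
    \<open>c * h ^ 3 / 24 + (A + B) * h / (4 * c)\<close> when \<open>A + B > 0\<close>.\<close>
  define c where "c = sqrt (6 * (A + B)) / h"
  \<comment> \<open>\<open>S\<close> is the chord of the squared derivative over
    \<open>{u..v}\<close>, and \<open>H p\<close> is an antiderivative of
    \<open>c * (t - p)\<^sup>2 / 2 + S t / (2 * c)\<close>.\<close>
  define S where "S = (\<lambda>t. (A * (v - t) + B * (t - u)) / h)"
  define H where "H = (\<lambda>p t. c * (t - p) ^ 3 / 6 + (B * (t - u)\<^sup>2 - A * (v - t)\<^sup>2) / (4 * c * h))"
  have h: "h > 0" and um: "u < m" "m < v" and AB: "A \<ge> 0" "B \<ge> 0"
    using uv by (auto simp: h_def m_def A_def B_def)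
  have c0: "c \<ge> 0" using h AB by (simp add: c_def)
  \<comment> \<open>Since \<open>h > 0\<close>, \<open>c = 0\<close> forces
    \<open>A + B = 0\<close>; the chord then vanishes, as the degenerate case of the pointwise bound
    requires.\<close>
  have cS: "S t = 0" if "c = 0" for t
  proof -
    have "A = 0" "B = 0" using that h AB by (auto simp: c_def add_nonneg_eq_0_iff)
    then show ?thesis by (simp add: S_def)
  qed
  have bound: "\<bar>(t - p) * f' t\<bar> \<le> c * (t - p)\<^sup>2 / 2 + S t / (2 * c)" if "t \<in> {u..v}" for p t
    using convex_on_le_chord[OF conv uv that] c0 cS
    by (intro abs_mult_le_weighted_squares) (auto simp: S_def A_def B_def h_def)
  have H: "(H p has_real_derivative c * (t - p)\<^sup>2 / 2 + S t / (2 * c)) (at t within T)" for p t T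
  proof (cases "c = 0")
    case True
    then show ?thesis by (simp add: H_def)
  next
    case False
    then show ?thesis using h unfolding H_def S_def
      by (auto intro!: derivative_eq_intros simp: field_simps power2_eq_square)
  qed
  \<comment> \<open>The choices \<open>p = u\<close> on the left half and \<open>p = v\<close> on
    the right half remove the boundary terms at \<open>u\<close> and \<open>v\<close>; those at
    \<open>m\<close> add up to the midpoint term.\<close>
  have "\<bar>(m - u) * f m - (u - u) * f u - integral {u..m} f\<bar> \<le> H u m - H u u"
  proof (rule parts_integral_bound[where f' = f', OF _ _ H bound])
    show "(f has_real_derivative f' t) (at t within {u..m})" if "t \<in> {u..m}" for t
      using that um by (intro has_field_derivative_subset[OF deriv]) auto
  qed (use um in auto)
  moreover have "\<bar>(v - v) * f v - (m - v) * f m - integral {m..v} f\<bar> \<le> H v v - H v m"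
  proof (rule parts_integral_bound[where f' = f', OF _ _ H bound])
    show "(f has_real_derivative f' t) (at t within {m..v})" if "t \<in> {m..v}" for t
      using that um by (intro has_field_derivative_subset[OF deriv]) auto
  qed (use um in auto)
  moreover have "integral {u..m} f + integral {m..v} f = integral {u..v} f"
  proof (rule Henstock_Kurzweil_Integration.integral_combine)
    have "continuous_on {u..v} f" by (rule DERIV_continuous_on) (rule deriv)
    then show "f integrable_on {u..v}" by (rule integrable_continuous_real)
  qed (use um in auto)
  moreover have "(m - u) * f m - (m - v) * f m = f m * (v - u)"
    by (simp add: algebra_simps)
  ultimately have "\<bar>integral {u..v} f - f m * (v - u)\<bar> \<le> (H u m - H u u) + (H v v - H v m)"
    by (simp add: abs_le_iff)
  \<comment> \<open>Each half contributes \<open>c * (h / 2) ^ 3 / 6\<close> from the cubic term.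
    The quadratic terms do not depend on \<open>p\<close>, so they cancel at
    \<open>m\<close>.\<close>
  also have "\<dots> = c * h ^ 3 / 24 + (A + B) * h / (4 * c)"
  proof -
    have eqs: "m - u = h / 2" "v - m = h / 2" "m - v = - (h / 2)" "v - u = h"
      by (auto simp: h_def m_def field_simps)
    show ?thesis unfolding H_def eqs diff_self using h
      by (cases "c = 0") (simp_all add: field_simps power2_eq_square power3_eq_cube)
  qed
  \<comment> \<open>At the optimal \<open>c\<close> the two summands are equal.\<close>
  also have "\<dots> = c * h ^ 3 / 12"
  proof (cases "c = 0")
    case True
    then show ?thesis by simp
  next
    case False
    have "(c * h)\<^sup>2 = 6 * (A + B)" using h AB by (simp add: c_def)
    then have AB_eq: "A + B = c\<^sup>2 * h\<^sup>2 / 6" by (simp add: power_mult_distrib)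
    show ?thesis unfolding AB_eq using False by (simp add: field_simps power2_eq_square power3_eq_cube)
  qed
  also have "\<dots> = 1 / (2 * sqrt 6) * (h\<^sup>2 * sqrt (B + A))"
  proof -
    have "sqrt 6 / 12 = 1 / (2 * sqrt 6)"
      using real_div_sqrt[of 6] by simp
    moreover have "c * h ^ 3 / 12 = sqrt 6 / 12 * (h\<^sup>2 * sqrt (B + A))"
    proof -
      have "sqrt (6 * (A + B)) = sqrt 6 * sqrt (B + A)"
        by (simp only: real_sqrt_mult add.commute)
      then have "c * h = sqrt 6 * sqrt (B + A)" using h by (simp add: c_def)
      then have "(c * h) * h\<^sup>2 / 12 = (sqrt 6 * sqrt (B + A)) * h\<^sup>2 / 12" by simp
      then show ?thesis by (simp add: power2_eq_square power3_eq_cube mult.commute mult.left_commute)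
    qed
    ultimately show ?thesis by (simp only:)
  qed
  finally show ?thesis by (simp add: h_def m_def A_def B_def)
qed

lemma division_mono:
  fixes x :: "nat \<Rightarrow> real"
  assumes "\<And>i. i < n \<Longrightarrow> x i < x (Suc i)" "i \<le> j" "j \<le> n"
  shows "x i \<le> x j"
  using assms(2,3)
proof (induction j rule: dec_induct)
  case (step k)
  then show ?case using assms(1)[of k] by simp
qed simp

lemma integral_division_sum:
  fixes f :: "real \<Rightarrow> real" and x :: "nat \<Rightarrow> real"
  assumes "\<And>i. i < n \<Longrightarrow> x i < x (Suc i)" "f integrable_on {x 0..x n}"
  shows "integral {x 0..x n} f = (\<Sum>i<n. integral {x i..x (Suc i)} f)"
  using assms
proof (induction n)
  case (Suc n)
  have le: "x 0 \<le> x n" "x n \<le> x (Suc n)"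
    using Suc.prems(1) by (auto intro!: division_mono[where n = "Suc n"])
  then have "f integrable_on {x 0..x n}"
    using Suc.prems(2) by (rule_tac integrable_subinterval_real) auto
  with Suc have "integral {x 0..x n} f = (\<Sum>i<n. integral {x i..x (Suc i)} f)"
    by simp
  moreover have "integral {x 0..x n} f + integral {x n..x (Suc n)} f = integral {x 0..x (Suc n)} f"
    using le Suc.prems(2) by (rule Henstock_Kurzweil_Integration.integral_combine)
  ultimately show ?case by simp
qed simp

theorem proposition5:
  fixes I :: "real set" and a b :: real and f f' :: "real \<Rightarrow> real"
    and n :: nat and x :: "nat \<Rightarrow> real"
  assumes "is_interval I" and "I \<subseteq> {0..}"
    and "a \<in> I" and "b \<in> I" and "a < b"
    and "\<And>t. t \<in> interior I \<union> {a, b} \<Longrightarrow> (f has_real_derivative f' t) (at t within I)"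
    and "f' absolutely_integrable_on {a..b}"
    and "convex_on {a..b} (\<lambda>t. \<bar>f' t\<bar>\<^sup>2)"
    and "is_division a b n x"
  shows "\<bar>midpoint_error f n x\<bar>
    \<le> 1 / (2 * sqrt 6) *
        (\<Sum>i<n. (x (Suc i) - x i)\<^sup>2 * sqrt (\<bar>f' (x (Suc i))\<bar>\<^sup>2 + \<bar>f' (x i)\<bar>\<^sup>2))"
proof -
  have sub: "{a..b} \<subseteq> I"
    using assms(1,3,4) mem_is_interval_1_I[of I a b] by fastforce
  \<comment> \<open>Only \<open>a\<close> and \<open>b\<close> can be boundary points of
    \<open>I\<close>, so the differentiability hypothesis reaches all of \<open>{a..b}\<close>;
    restricting it from \<open>I\<close> makes it one-sided at the ends.\<close>
  have "{a<..<b} \<subseteq> interior I"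
    using sub by (intro interior_maximal) auto
  then have "{a..b} \<subseteq> interior I \<union> {a, b}"
    using atLeastAtMost_diff_ends[of a b] by blast
  then have deriv: "(f has_real_derivative f' t) (at t within {a..b})" if "t \<in> {a..b}" for t
    using that by (intro has_field_derivative_subset[OF assms(6) sub]) auto
  have x: "x 0 = a" "x n = b" and inc: "\<And>i. i < n \<Longrightarrow> x i < x (Suc i)"
    using assms(9) by (auto simp: is_division_def)
  have "continuous_on {a..b} f"
    by (rule DERIV_continuous_on) (rule deriv)
  then have "f integrable_on {x 0..x n}"
    by (simp add: x integrable_continuous_real)
  then have "midpoint_error f n x =
      (\<Sum>i<n. integral {x i..x (Suc i)} f - f ((x i + x (Suc i)) / 2) * (x (Suc i) - x i))"
    using integral_division_sum[of n x f] inc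
    by (simp add: midpoint_error_def midpoint_sum_def sum_subtractf)
  also have "\<bar>\<dots>\<bar> \<le> (\<Sum>i<n. 1 / (2 * sqrt 6) *
      ((x (Suc i) - x i)\<^sup>2 * sqrt ((f' (x (Suc i)))\<^sup>2 + (f' (x i))\<^sup>2)))"
  \<comment> \<open>The triangle inequality reduces the claim to one subinterval, which inherits
    differentiability and convexity from \<open>{a..b}\<close>.\<close>
  proof (rule order_trans[OF sum_abs], rule sum_mono)
    fix i assume "i \<in> {..<n}"
    then have i: "i < n" by simp
    have sub': "{x i..x (Suc i)} \<subseteq> {a..b}"
      using division_mono[of n x 0 i] division_mono[of n x "Suc i" n] inc i x by auto
    show "\<bar>integral {x i..x (Suc i)} f - f ((x i + x (Suc i)) / 2) * (x (Suc i) - x i)\<bar>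
      \<le> 1 / (2 * sqrt 6) *
        ((x (Suc i) - x i)\<^sup>2 * sqrt ((f' (x (Suc i)))\<^sup>2 + (f' (x i))\<^sup>2))"
    proof (rule midpoint_rule_error[OF inc[OF i]])
      show "(f has_real_derivative f' t) (at t within {x i..x (Suc i)})"
        if "t \<in> {x i..x (Suc i)}" for t
        using that sub' by (intro has_field_derivative_subset[OF deriv sub']) auto
      show "convex_on {x i..x (Suc i)} (\<lambda>t. (f' t)\<^sup>2)"
        using convex_on_subset[OF assms(8) sub'] by simp
    qed
  qed
  finally show ?thesis by (simp add: sum_distrib_left)
qed

end
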